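(* If $r\geq 1$ and $\mathfrak{g}=\mathfrak{sl}_{r+1}(\mathbb{C})$, with $\tilde{\alpha}=\alpha_1+\cdots+\alpha_r$ the sum of all simple roots, then $|\mathcal{CA}(\tilde{\alpha},0)|=F_r$.
   Context: Let $W$ be the Weyl group of $\mathfrak{g}$, generated by the simple reflections $s_1,\dots,s_r$, and $\rho$ half the sum of the positive roots. Kostant's partition function $\wp(\xi)$ is the number of ways to write $\xi\in\mathfrak{h}^*$ as a nonnegative integral sum of positive roots. For integral weights $\lambda,\mu$, the Weyl alternation set is $\mathcal{A}(\lambda,\mu)=\{\sigma\in W:\wp(\sigma(\lambda+\rho)-(\mu+\rho))>0\}$, and the collapsed Weyl alternation set is $$\mathcal{CA}(\lambda,\mu)=\{\sigma\in\mathcal{A}(\lambda,\mu): \text{there is no simple reflection } s_i\in W \text{ with } \wp(\sigma(\lambda+\rho)-\rho-\mu)=\wp(\sigma s_i(\lambda+\rho)-\rho-\mu)\}.$$ $F_n$ denotes the $n$-th Fibonacci number: $F_0=0$, $F_1=1$, $F_n=F_{n-1}+F_{n-2}$. *)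

theory Defs
  imports
    "HOL-Library.Function_Algebras"
    "HOL-Library.Multiset"
    "HOL-Algebra.Bij"
    "HOL-Algebra.Generated_Groups"
    "HOL-Number_Theory.Fib"
    "Jordan_Normal_Form.Matrix"
begin

definition special_linear :: "nat \<Rightarrow> complex mat set" where
  "special_linear n = {X \<in> carrier_mat n n. (\<Sum>i<n. X $$ (i, i)) = 0}"

definition cartan :: "nat \<Rightarrow> complex mat set" where
  "cartan n = {H \<in> special_linear n. diagonal_mat H}"

type_synonym weight = "complex mat \<Rightarrow> complex"

text \<open>Functionals on the Cartan subalgebra are extended by 0 to all matrices, so that
  equality, addition and 0 of functions are those of the dual space.\<close>

definition cartan_dual :: "nat \<Rightarrow> weight set" where
  "cartan_dual n = {f.
     (\<forall>A \<in> cartan n. \<forall>B \<in> cartan n. f (A + B) = f A + f B) \<and>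
     (\<forall>c. \<forall>A \<in> cartan n. f (c \<cdot>\<^sub>m A) = c * f A) \<and>
     (\<forall>A. A \<notin> cartan n \<longrightarrow> f A = 0)}"

definition root_space :: "nat \<Rightarrow> weight \<Rightarrow> complex mat set" where
  "root_space n \<alpha> =
     {X \<in> special_linear n. \<forall>H \<in> cartan n. H * X - X * H = \<alpha> H \<cdot>\<^sub>m X}"

definition roots :: "nat \<Rightarrow> weight set" where
  "roots n = {\<alpha> \<in> cartan_dual n. \<alpha> \<noteq> 0 \<and> (\<exists>X \<in> root_space n \<alpha>. X \<noteq> 0\<^sub>m n n)}"

text \<open>Simple roots are indexed from 0: those of \<open>special_linear n\<close> are
  \<open>simple_root n i\<close> with \<open>Suc i < n\<close>.\<close>

definition simple_root :: "nat \<Rightarrow> nat \<Rightarrow> weight" where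
  "simple_root n i = (\<lambda>H. if H \<in> cartan n then H $$ (i, i) - H $$ (Suc i, Suc i) else 0)"

definition simple_coroot :: "nat \<Rightarrow> nat \<Rightarrow> complex mat" where
  "simple_coroot n i =
     mat n n (\<lambda>(j, k). if j = k \<and> j = i then 1 else if j = k \<and> j = Suc i then - 1 else 0)"

definition positive_roots :: "nat \<Rightarrow> weight set" where
  "positive_roots n =
     {\<alpha> \<in> roots n. \<exists>c :: nat \<Rightarrow> nat. \<alpha> = (\<Sum>i | Suc i < n. (\<lambda>H. of_nat (c i) * simple_root n i H))}"

definition half_sum :: "nat \<Rightarrow> weight" where
  "half_sum n = (\<lambda>H. (\<Sum>\<alpha> \<in> positive_roots n. \<alpha> H) / 2)"

definition simple_reflection :: "nat \<Rightarrow> nat \<Rightarrow> weight \<Rightarrow> weight" where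
  "simple_reflection n i =
     (\<lambda>\<xi> \<in> cartan_dual n. \<xi> - (\<lambda>H. \<xi> (simple_coroot n i) * simple_root n i H))"

definition weyl_group :: "nat \<Rightarrow> (weight \<Rightarrow> weight) set" where
  "weyl_group n = generate (BijGroup (cartan_dual n)) {simple_reflection n i | i. Suc i < n}"

text \<open>A way to write \<open>\<xi>\<close> as a nonnegative integral sum of positive roots is a multiset
  of positive roots with sum \<open>\<xi>\<close>. There are only finitely many, so \<open>card\<close> counts them.\<close>

definition kostant_partition :: "nat \<Rightarrow> weight \<Rightarrow> nat" where
  "kostant_partition n \<xi> = card {M. set_mset M \<subseteq> positive_roots n \<and> sum_mset M = \<xi>}"

definition weyl_alternation_set :: "nat \<Rightarrow> weight \<Rightarrow> weight \<Rightarrow> (weight \<Rightarrow> weight) set" where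
  "weyl_alternation_set n lam mu =
     {\<sigma> \<in> weyl_group n.
        kostant_partition n (\<sigma> (lam + half_sum n) - (mu + half_sum n)) > 0}"

definition collapsed_weyl_alternation_set ::
    "nat \<Rightarrow> weight \<Rightarrow> weight \<Rightarrow> (weight \<Rightarrow> weight) set" where
  "collapsed_weyl_alternation_set n lam mu =
     {\<sigma> \<in> weyl_alternation_set n lam mu.
        \<not> (\<exists>i. Suc i < n \<and>
              kostant_partition n (\<sigma> (lam + half_sum n) - half_sum n - mu) =
              kostant_partition n
                ((\<sigma> \<otimes>\<^bsub>BijGroup (cartan_dual n)\<^esub> simple_reflection n i) (lam + half_sum n)
                   - half_sum n - mu))}"

end

theory Submission
  imports Defs "HOL-Combinatorics.Permutations"
begin

text \<open>
  Let \<open>n = r + 1\<close> and let \<open>\<alpha>\<close> be the highest root. On diagonal traceless matrices the Weyl group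
  permutes the diagonal entries. A weight is written as an integer vector \<open>a\<close>, acting by
  \<open>H \<mapsto> \<Sum>i. a\<^sub>i H\<^sub>i\<^sub>i\<close>; then \<open>\<rho> = (0, -1, \<dots>, -(n - 1))\<close> and
  \<open>\<alpha> + \<rho> = (1, -1, -2, \<dots>, -(n - 2), -n)\<close>. If \<open>\<Sum>i. a\<^sub>i = 0\<close>, the coefficients of \<open>a\<close> in the
  simple roots are its partial sums, and they are the values of \<open>a\<close> at the fundamental
  coweights. Hence \<open>\<wp>(\<sigma>(\<alpha> + \<rho>) - \<rho>) > 0\<close> forces these partial sums to be nonnegative. Comparing
  the sum of \<open>k + 1\<close> distinct naturals with \<open>0 + \<dots> + k\<close>, one finds that \<open>\<sigma>\<close> must fix the first
  and the last index and be a product of the commuting adjacent transpositions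
  \<open>(j, j + 1)\<close> with \<open>j\<close> in a set \<open>J \<subseteq> {1..<r - 1}\<close> without consecutive elements
  (\<open>nonneg_partial_sums_imp_flip\<close>). Conversely, for such \<open>J\<close> the weight \<open>\<sigma>(\<alpha> + \<rho>) - \<rho>\<close> is the
  sum of the simple roots with index outside \<open>J\<close> (\<open>shifted_weight_flip\<close>), so \<open>\<sigma>\<close> belongs to
  the alternation set. There are \<open>F\<^sub>r\<close> such sets \<open>J\<close> (\<open>card_sparse_sets\<close>).

  Collapsing removes nothing. Suppose that \<open>\<sigma>\<close>, given by \<open>J\<close>, and \<open>\<sigma> s\<^sub>i\<close> have the same value of
  \<open>\<wp>\<close>. As this value is positive, \<open>\<sigma> s\<^sub>i\<close> is given by a set \<open>K\<close> too, and \<open>J\<close> and \<open>K\<close> differ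
  exactly by the element \<open>i\<close> (\<open>flip_adj_swap_eq_flip\<close>). But removing an element from the set
  adds a simple root to the weight whose neighbour is already present, and this strictly
  increases the number of partitions (\<open>kostant_partition_insert_less\<close>).
\<close>

section \<open>The Cartan subalgebra\<close>

lemma cartan_iff:
  "H \<in> cartan n \<longleftrightarrow>
     H \<in> carrier_mat n n \<and> (\<Sum>i<n. H $$ (i, i)) = 0 \<and>
     (\<forall>i<n. \<forall>j<n. i \<noteq> j \<longrightarrow> H $$ (i, j) = 0)"
  unfolding cartan_def special_linear_def diagonal_mat_def by auto

lemma add_cartan: "A \<in> cartan n \<Longrightarrow> B \<in> cartan n \<Longrightarrow> A + B \<in> cartan n"
  by (auto simp: cartan_iff sum.distrib)

lemma smult_cartan: "A \<in> cartan n \<Longrightarrow> c \<cdot>\<^sub>m A \<in> cartan n"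
  by (auto simp: cartan_iff simp flip: sum_distrib_left)

lemma sum_fun_apply: "(\<Sum>x\<in>A. f x) y = (\<Sum>x\<in>A. f x y)"
  for f :: "'a \<Rightarrow> 'b \<Rightarrow> 'c::comm_monoid_add"
  by (induction A rule: infinite_finite_induct) auto

section \<open>The Weyl group as permutations of the diagonal entries\<close>

text \<open>The simultaneous permutation of rows and columns; on a diagonal matrix it permutes the
  diagonal entries.\<close>

definition permute_mat :: "nat \<Rightarrow> (nat \<Rightarrow> nat) \<Rightarrow> complex mat \<Rightarrow> complex mat" where
  "permute_mat n p H = mat n n (\<lambda>(i, j). H $$ (p i, p j))"

text \<open>The action of a permutation \<open>p\<close> of the indices on the dual of the Cartan subalgebra, by
  precomposition with \<open>permute_mat n p\<close>. As an element of a group of bijections it is undefined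
  outside the dual space, and its values vanish outside the Cartan subalgebra. It is
  multiplicative in \<open>p\<close>, without reversal of the order: \<open>permute_mat\<close> reverses it once and
  precomposition a second time.\<close>

definition weyl_perm :: "nat \<Rightarrow> (nat \<Rightarrow> nat) \<Rightarrow> weight \<Rightarrow> weight" where
  "weyl_perm n p =
     (\<lambda>\<xi> \<in> cartan_dual n. \<lambda>H. if H \<in> cartan n then \<xi> (permute_mat n p H) else 0)"

lemma permute_mat_index [simp]:
  "i < n \<Longrightarrow> j < n \<Longrightarrow> permute_mat n p H $$ (i, j) = H $$ (p i, p j)"
  by (simp add: permute_mat_def)

lemma permute_mat_carrier [simp]: "permute_mat n p H \<in> carrier_mat n n"
  by (simp add: permute_mat_def)

lemma permutes_lessThan_less: "p permutes {..<n} \<Longrightarrow> i < n \<Longrightarrow> p i < (n::nat)"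
  by (metis lessThan_iff permutes_in_image)

lemma permute_mat_cartan:
  assumes p: "p permutes {..<n}" and H: "H \<in> cartan n"
  shows "permute_mat n p H \<in> cartan n"
proof -
  have "(\<Sum>i<n. permute_mat n p H $$ (i, i)) = (\<Sum>i<n. H $$ (p i, p i))"
    by (intro sum.cong) auto
  also have "\<dots> = (\<Sum>i<n. H $$ (i, i))"
    using sum.permute[OF p, of "\<lambda>i. H $$ (i, i)"] by (simp add: o_def)
  finally show ?thesis
    using H permutes_lessThan_less[OF p] inj_eq[OF permutes_inj[OF p]]
    by (auto simp: cartan_iff)
qed

lemma permute_mat_add:
  assumes p: "p permutes {..<n}" and "A \<in> cartan n" "B \<in> cartan n"
  shows "permute_mat n p (A + B) = permute_mat n p A + permute_mat n p B"
  using assms(2,3) permutes_lessThan_less[OF p]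
  by (intro eq_matI) (auto simp: cartan_iff permute_mat_def)

lemma permute_mat_smult:
  assumes p: "p permutes {..<n}" and "A \<in> cartan n"
  shows "permute_mat n p (c \<cdot>\<^sub>m A) = c \<cdot>\<^sub>m permute_mat n p A"
  using assms(2) permutes_lessThan_less[OF p]
  by (intro eq_matI) (auto simp: cartan_iff permute_mat_def)

lemma permute_mat_comp:
  assumes q: "q permutes {..<n}"
  shows "permute_mat n q (permute_mat n p H) = permute_mat n (p \<circ> q) H"
  using permutes_lessThan_less[OF q]
  by (intro eq_matI) (auto simp: permute_mat_def)

lemma permute_mat_id: "H \<in> carrier_mat n n \<Longrightarrow> permute_mat n id H = H"
  by (intro eq_matI) (auto simp: permute_mat_def)

lemma weyl_perm_apply:
  "\<xi> \<in> cartan_dual n \<Longrightarrow>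
   weyl_perm n p \<xi> = (\<lambda>H. if H \<in> cartan n then \<xi> (permute_mat n p H) else 0)"
  by (simp add: weyl_perm_def)

lemma weyl_perm_mem:
  assumes p: "p permutes {..<n}" and \<xi>: "\<xi> \<in> cartan_dual n"
  shows "weyl_perm n p \<xi> \<in> cartan_dual n"
  using \<xi> permute_mat_cartan[OF p]
  by (auto simp: weyl_perm_apply[OF \<xi>] cartan_dual_def permute_mat_add[OF p]
      permute_mat_smult[OF p] add_cartan smult_cartan)

lemma weyl_perm_comp_apply:
  assumes p: "p permutes {..<n}" and q: "q permutes {..<n}" and \<xi>: "\<xi> \<in> cartan_dual n"
  shows "weyl_perm n p (weyl_perm n q \<xi>) = weyl_perm n (p \<circ> q) \<xi>"
  using permute_mat_cartan[OF p]
  unfolding weyl_perm_apply[OF weyl_perm_mem[OF q \<xi>]]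
  by (auto simp: weyl_perm_apply[OF \<xi>] permute_mat_comp[OF q])

lemma weyl_perm_id_apply: "\<xi> \<in> cartan_dual n \<Longrightarrow> weyl_perm n id \<xi> = \<xi>"
  by (auto simp: weyl_perm_apply permute_mat_id cartan_iff cartan_dual_def fun_eq_iff)

lemma weyl_perm_Bij:
  assumes p: "p permutes {..<n}"
  shows "weyl_perm n p \<in> Bij (cartan_dual n)"
proof -
  have p': "Hilbert_Choice.inv p permutes {..<n}"
    using p by (rule permutes_inv)
  have "bij_betw (weyl_perm n p) (cartan_dual n) (cartan_dual n)"
    by (rule bij_betw_byWitness[where f' = "weyl_perm n (Hilbert_Choice.inv p)"])
      (use p p' weyl_perm_mem[OF p] weyl_perm_mem[OF p'] in
        \<open>auto simp: weyl_perm_comp_apply weyl_perm_id_apply permutes_inv_o[OF p]\<close>)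
  then show ?thesis
    by (simp add: Bij_def weyl_perm_def)
qed

lemma weyl_perm_mult:
  assumes p: "p permutes {..<n}" and q: "q permutes {..<n}"
  shows "weyl_perm n p \<otimes>\<^bsub>BijGroup (cartan_dual n)\<^esub> weyl_perm n q = weyl_perm n (p \<circ> q)"
proof -
  have "weyl_perm n p \<otimes>\<^bsub>BijGroup (cartan_dual n)\<^esub> weyl_perm n q =
      compose (cartan_dual n) (weyl_perm n p) (weyl_perm n q)"
    by (simp add: BijGroup_def weyl_perm_Bij p q)
  also have "\<dots> = weyl_perm n (p \<circ> q)"
    by (rule extensionalityI[where A = "cartan_dual n"])
      (simp_all add: compose_eq weyl_perm_comp_apply p q, simp add: weyl_perm_def)
  finally show ?thesis .
qed

lemma weyl_perm_one: "\<one>\<^bsub>BijGroup (cartan_dual n)\<^esub> = weyl_perm n id"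
  by (rule extensionalityI[where A = "cartan_dual n"])
    (simp_all add: BijGroup_def weyl_perm_id_apply, simp add: weyl_perm_def)

lemma weyl_perm_inv:
  assumes p: "p permutes {..<n}"
  shows "inv\<^bsub>BijGroup (cartan_dual n)\<^esub> (weyl_perm n p) = weyl_perm n (Hilbert_Choice.inv p)"
proof (rule group.inv_equality[OF group_BijGroup])
  have p': "Hilbert_Choice.inv p permutes {..<n}"
    using p by (rule permutes_inv)
  show "weyl_perm n (Hilbert_Choice.inv p) \<otimes>\<^bsub>BijGroup (cartan_dual n)\<^esub> weyl_perm n p =
      \<one>\<^bsub>BijGroup (cartan_dual n)\<^esub>"
    by (simp add: weyl_perm_mult p p' weyl_perm_one permutes_inv_o[OF p])
  show "weyl_perm n p \<in> carrier (BijGroup (cartan_dual n))"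
    "weyl_perm n (Hilbert_Choice.inv p) \<in> carrier (BijGroup (cartan_dual n))"
    by (simp_all add: BijGroup_def weyl_perm_Bij p p')
qed

text \<open>The transposition of the indices \<open>i\<close> and \<open>i + 1\<close>.\<close>

abbreviation adj_swap :: "nat \<Rightarrow> nat \<Rightarrow> nat" where
  "adj_swap i \<equiv> Transposition.transpose i (Suc i)"

lemma adj_swap_permutes: "Suc i < n \<Longrightarrow> adj_swap i permutes {..<n}"
  by (rule permutes_swap_id) auto

lemma simple_coroot_carrier [simp]: "simple_coroot n i \<in> carrier_mat n n"
  by (simp add: simple_coroot_def)

lemma simple_coroot_cartan:
  assumes "Suc i < n"
  shows "simple_coroot n i \<in> cartan n"
proof -
  have "(\<Sum>j<n. simple_coroot n i $$ (j, j)) =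
      (\<Sum>j<n. (if j = i then 1 else 0) - (if j = Suc i then 1 else 0))"
    by (intro sum.cong) (auto simp: simple_coroot_def)
  also have "\<dots> = 0"
    using assms by (simp add: sum_subtractf)
  finally show ?thesis
    by (auto simp: cartan_iff simple_coroot_def)
qed

text \<open>For a linear functional, \<open>\<xi>(H) - \<xi>(h\<^sub>i) \<alpha>\<^sub>i(H) = \<xi>(H - \<alpha>\<^sub>i(H) h\<^sub>i)\<close>, and subtracting
  \<open>\<alpha>\<^sub>i(H) h\<^sub>i\<close> from a diagonal matrix exchanges two adjacent diagonal entries.\<close>

lemma simple_reflection_eq_weyl_perm:
  assumes i: "Suc i < n"
  shows "simple_reflection n i = weyl_perm n (adj_swap i)"
proof (rule extensionalityI[where A = "cartan_dual n"])
  fix \<xi> assume \<xi>: "\<xi> \<in> cartan_dual n"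
  show "simple_reflection n i \<xi> = weyl_perm n (adj_swap i) \<xi>"
  proof
    fix H
    show "simple_reflection n i \<xi> H = weyl_perm n (adj_swap i) \<xi> H"
    proof (cases "H \<in> cartan n")
      case True
      define c where "c = - (H $$ (i, i) - H $$ (Suc i, Suc i))"
      have "permute_mat n (adj_swap i) H = H + c \<cdot>\<^sub>m simple_coroot n i"
        using True i
        by (intro eq_matI)
          (auto simp: cartan_iff c_def permute_mat_def simple_coroot_def transpose_def)
      moreover have "\<xi> (H + c \<cdot>\<^sub>m simple_coroot n i) = \<xi> H + c * \<xi> (simple_coroot n i)"
        using \<xi> True simple_coroot_cartan[OF i] smult_cartan[OF simple_coroot_cartan[OF i], of c]
        by (simp add: cartan_dual_def)
      ultimately show ?thesis
        using True \<xi>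
        by (simp add: weyl_perm_apply simple_reflection_def simple_root_def c_def algebra_simps)
    next
      case False
      then show ?thesis
        using \<xi> by (auto simp: weyl_perm_apply simple_reflection_def simple_root_def cartan_dual_def)
    qed
  qed
qed (simp_all add: simple_reflection_def weyl_perm_def)

text \<open>Every permutation does arise from the Weyl group, but only products of commuting
  adjacent transpositions will be needed for that direction.\<close>

lemma weyl_group_subset_weyl_perm:
  assumes "\<sigma> \<in> weyl_group n"
  shows "\<exists>p. p permutes {..<n} \<and> \<sigma> = weyl_perm n p"
  using assms unfolding weyl_group_def
proof (induction rule: generate.induct)
  case one
  show ?case
    using weyl_perm_one permutes_id by blast
next
  case (incl h)
  then show ?case
    using simple_reflection_eq_weyl_perm adj_swap_permutes by blast
next
  case (inv h)
  then obtain i where i: "Suc i < n" "h = weyl_perm n (adj_swap i)"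
    using simple_reflection_eq_weyl_perm by auto
  show ?case
    using weyl_perm_inv[OF adj_swap_permutes[OF i(1)]] permutes_inv[OF adj_swap_permutes[OF i(1)]]
    unfolding i(2) by blast
next
  case (eng h1 h2)
  then obtain p q where "p permutes {..<n}" "h1 = weyl_perm n p"
    "q permutes {..<n}" "h2 = weyl_perm n q"
    by blast
  then show ?case
    using weyl_perm_mult permutes_compose by blast
qed

section \<open>Sparse sets and their involutions\<close>

text \<open>The subsets of \<open>{1..<m}\<close> without two consecutive elements.\<close>

definition sparse_sets :: "nat \<Rightarrow> nat set set" where
  "sparse_sets m = {J. \<forall>j\<in>J. 0 < j \<and> j < m \<and> Suc j \<notin> J}"

text \<open>For a set \<open>J\<close> without consecutive elements, the product of the disjoint transpositions
  \<open>(j, j + 1)\<close> with \<open>j \<in> J\<close>.\<close>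

definition flip :: "nat set \<Rightarrow> nat \<Rightarrow> nat" where
  "flip J k = (if k \<in> J then Suc k else if 0 < k \<and> k - 1 \<in> J then k - 1 else k)"

lemma finite_sparse_sets: "finite (sparse_sets m)"
  by (rule finite_subset[of _ "Pow {..<m}"]) (auto simp: sparse_sets_def)

lemma sparse_sets_subset: "J \<in> sparse_sets m \<Longrightarrow> K \<subseteq> J \<Longrightarrow> K \<in> sparse_sets m"
  by (auto simp: sparse_sets_def)

lemma card_sparse_sets: "card (sparse_sets m) = fib (Suc m)"
proof (induction m rule: fib.induct)
  case 1
  have "sparse_sets 0 = {{}}"
    by (auto simp: sparse_sets_def)
  then show ?case by simp
next
  case 2
  have "sparse_sets (Suc 0) = {{}}"
    by (auto simp: sparse_sets_def)
  then show ?case by simp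
next
  case (3 m)
  \<comment> \<open>Case distinction on whether the largest possible element \<open>m + 1\<close> belongs to the set.\<close>
  have split: "sparse_sets (Suc (Suc m)) =
      sparse_sets (Suc m) \<union> insert (Suc m) ` sparse_sets m"
  proof (intro equalityI subsetI)
    fix J assume "J \<in> sparse_sets (Suc (Suc m))"
    then have J: "0 < j" "j < Suc (Suc m)" "Suc j \<notin> J" if "j \<in> J" for j
      using that by (auto simp: sparse_sets_def)
    show "J \<in> sparse_sets (Suc m) \<union> insert (Suc m) ` sparse_sets m"
    proof (cases "Suc m \<in> J")
      case True
      then have "m \<notin> J"
        using J(3) by blast
      have "j < m" if "j \<in> J - {Suc m}" for j
        using that J(2)[of j] \<open>m \<notin> J\<close> by (metis Diff_iff less_antisym singletonI)
      then have "J - {Suc m} \<in> sparse_sets m"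
        using J by (simp add: sparse_sets_def)
      moreover have "J = insert (Suc m) (J - {Suc m})"
        using True by blast
      ultimately show ?thesis
        by blast
    next
      case False
      then have "j < Suc m" if "j \<in> J" for j
        using J(2)[OF that] that by (metis less_antisym)
      then show ?thesis
        using J by (simp add: sparse_sets_def)
    qed
  next
    fix J assume "J \<in> sparse_sets (Suc m) \<union> insert (Suc m) ` sparse_sets m"
    then show "J \<in> sparse_sets (Suc (Suc m))"
      by (auto simp: sparse_sets_def)
  qed
  have "card (sparse_sets (Suc (Suc m))) =
      card (sparse_sets (Suc m)) + card (insert (Suc m) ` sparse_sets m)"
    unfolding split
    by (intro card_Un_disjoint finite_imageI finite_sparse_sets)
      (auto simp: sparse_sets_def)
  also have "card (insert (Suc m) ` sparse_sets m) = card (sparse_sets m)"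
  proof (rule card_image, rule inj_onI)
    fix J K assume JK: "J \<in> sparse_sets m" "K \<in> sparse_sets m" "insert (Suc m) J = insert (Suc m) K"
    then have "Suc m \<notin> J" "Suc m \<notin> K"
      by (auto simp: sparse_sets_def)
    with JK(3) show "J = K"
      by (metis insert_ident)
  qed
  finally show ?case
    using 3 by simp
qed

lemma flip_involution:
  assumes J: "J \<in> sparse_sets m"
  shows "flip J (flip J k) = k"
proof -
  have "k - 1 \<notin> J" if "k \<in> J" "0 < k"
    using J that unfolding sparse_sets_def by (cases k) auto
  moreover have "Suc k \<notin> J" if "k \<in> J"
    using J that by (auto simp: sparse_sets_def)
  ultimately show ?thesis
    by (auto simp: flip_def)
qed

lemma flip_permutes:
  assumes J: "J \<in> sparse_sets m" and n: "m < n"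
  shows "flip J permutes {..<n}"
proof (rule bij_imp_permutes)
  have "flip J k < n" if "k < n" for k
    using J n that by (auto simp: flip_def sparse_sets_def)
  then show "bij_betw (flip J) {..<n} {..<n}"
    by (intro bij_betw_byWitness[where f' = "flip J"]) (auto simp: flip_involution[OF J])
  show "flip J x = x" if "x \<notin> {..<n}" for x
  proof -
    have "x \<notin> J" "x - 1 \<notin> J"
      using J n that unfolding sparse_sets_def by force+
    then show ?thesis by (simp add: flip_def)
  qed
qed

lemma inv_flip:
  assumes J: "J \<in> sparse_sets m"
  shows "Hilbert_Choice.inv (flip J) = flip J"
  by (rule inv_unique_comp) (auto simp: flip_involution[OF J] fun_eq_iff)

lemma flip_eq_Suc_iff: "flip J k = Suc k \<longleftrightarrow> k \<in> J"
  by (auto simp: flip_def)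

lemma flip_inj: "flip J = flip K \<Longrightarrow> J = K"
  by (rule Set.set_eqI) (simp flip: flip_eq_Suc_iff)

lemma flip_empty: "flip {} = id"
  by (simp add: flip_def fun_eq_iff)

lemma flip_insert:
  assumes "insert i J \<in> sparse_sets m" "i \<notin> J"
  shows "flip (insert i J) = adj_swap i \<circ> flip J" "flip (insert i J) = flip J \<circ> adj_swap i"
proof -
  have i: "Suc i \<notin> J" "0 < i" "i - 1 \<notin> J"
  proof -
    show "Suc i \<notin> J" "0 < i"
      using assms by (auto simp: sparse_sets_def)
    then show "i - 1 \<notin> J"
      using assms by (cases i) (auto simp: sparse_sets_def)
  qed
  have eq: "flip (insert i J) k = adj_swap i (flip J k) \<and> flip (insert i J) k = flip J (adj_swap i k)" for k
  proof (cases "k = i \<or> k = Suc i")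
    case True
    then show ?thesis
      using i assms(2) by (auto simp: flip_def)
  next
    case False
    then have "flip J k \<noteq> i" "flip J k \<noteq> Suc i" "flip (insert i J) k = flip J k"
      using i assms(2) by (auto simp: flip_def)
    with False show ?thesis
      by (auto simp: transpose_def)
  qed
  show "flip (insert i J) = adj_swap i \<circ> flip J"
    using eq by (intro ext) simp
  show "flip (insert i J) = flip J \<circ> adj_swap i"
    using conjunct2[OF eq] by (intro ext) simp
qed

text \<open>An adjacent transposition carries one flip to another only by inserting or removing its
  own index.\<close>

lemma flip_adj_swap_eq_flip:
  assumes J: "J \<in> sparse_sets m" and K: "K \<in> sparse_sets m"
    and eq: "flip J \<circ> adj_swap i = flip K"
  shows "i \<notin> J \<and> K = insert i J \<or> i \<notin> K \<and> J = insert i K"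
proof -
  have swap: "flip K k = flip J (adj_swap i k)" for k
    using eq by (metis o_apply)
  have "i \<in> J \<or> i \<in> K"
  proof (rule ccontr)
    assume n: "\<not> (i \<in> J \<or> i \<in> K)"
    then have "Suc i \<le> flip J (Suc i)" "flip K i \<le> i"
      by (auto simp: flip_def)
    then show False
      using swap[of i] by simp
  qed
  then show ?thesis
  proof
    assume i: "i \<in> J"
    define J' where "J' = J - {i}"
    have J': "J = insert i J'" "i \<notin> J'"
      using i by (auto simp: J'_def)
    have "flip K k = flip J' k" for k
      using swap[of k] flip_insert(2)[of i J' m] J J' by simp
    then show ?thesis
      using J' flip_inj by (metis ext)
  next
    assume i: "i \<in> K"
    define K' where "K' = K - {i}"
    have K': "K = insert i K'" "i \<notin> K'"
      using i by (auto simp: K'_def)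
    have "flip J k = flip K' k" for k
      using swap[of "adj_swap i k"] flip_insert(2)[of i K' m] K K' by simp
    then show ?thesis
      using K' flip_inj by (metis ext)
  qed
qed

section \<open>Partial sums of displacements\<close>

text \<open>Among sets of \<open>k + 1\<close> naturals \<open>{..k}\<close> has the least sum, and each element above \<open>k\<close>
  costs at least one.\<close>

lemma sum_atMost_le_sum:
  assumes "finite U" "card U = Suc k"
  shows "\<Sum>{..k} + card (U - {..k}) \<le> \<Sum>U"
proof -
  let ?K = "{..k}"
  have "card (U - ?K) = card (?K - U)"
    using card_Diff_subset_Int[of U ?K] card_Diff_subset_Int[of ?K U] assms
    by (simp add: Int_commute)
  have "\<Sum>(?K - U) \<le> card (?K - U) * k"
    using sum_bounded_above[of "?K - U" "\<lambda>x. x" k] by auto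
  moreover have "card (U - ?K) * Suc k \<le> \<Sum>(U - ?K)"
    using sum_bounded_below[of "U - ?K" "Suc k" "\<lambda>x. x"] by auto
  moreover have "\<Sum>?K = \<Sum>(?K \<inter> U) + \<Sum>(?K - U)"
    using sum.Int_Diff[of ?K "\<lambda>x. x" U] by simp
  moreover have "\<Sum>U = \<Sum>(?K \<inter> U) + \<Sum>(U - ?K)"
    using sum.Int_Diff[of U "\<lambda>x. x" ?K] assms by (simp add: Int_commute)
  ultimately show ?thesis
    using \<open>card (U - ?K) = card (?K - U)\<close> by simp
qed

text \<open>The partial sums of the displacements \<open>u i - i\<close>. They are kept in the integers, since
  single displacements may be negative.\<close>

definition displacement :: "(nat \<Rightarrow> nat) \<Rightarrow> nat \<Rightarrow> int" where
  "displacement u k = (\<Sum>i\<le>k. int (u i) - int i)"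

lemma displacement_ge_card:
  assumes "inj u"
  shows "int (card (u ` {..k} - {..k})) \<le> displacement u k"
proof -
  have inj: "inj_on u {..k}"
    using assms by (rule inj_on_subset) simp
  have "\<Sum>{..k} + card (u ` {..k} - {..k}) \<le> \<Sum>(u ` {..k})"
    by (rule sum_atMost_le_sum) (simp_all add: card_image inj)
  also have "\<Sum>(u ` {..k}) = (\<Sum>i\<le>k. u i)"
    by (simp add: sum.reindex inj)
  finally have "int (\<Sum>{..k} + card (u ` {..k} - {..k})) \<le> int (\<Sum>i\<le>k. u i)"
    by linarith
  then show ?thesis
    unfolding displacement_def by (simp add: sum_subtractf)
qed

text \<open>The coordinates \<open>(1, -1, -2, \<dots>, -(n - 2), -n)\<close> of \<open>\<alpha> + \<rho>\<close>, where \<open>\<alpha>\<close> is the highest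
  root.\<close>

definition highest_rho :: "nat \<Rightarrow> nat \<Rightarrow> int" where
  "highest_rho n j = (if j = 0 then 1 else 0) - (if Suc j = n then 1 else 0) - int j"

lemma displacement_flip:
  assumes J: "J \<in> sparse_sets m"
  shows "displacement (flip J) k = (if k \<in> J then 1 else 0)"
proof (induction k)
  case 0
  have "0 \<notin> J"
    using J by (auto simp: sparse_sets_def)
  then show ?case
    by (simp add: displacement_def flip_def)
next
  case (Suc k)
  have "displacement (flip J) (Suc k) =
      displacement (flip J) k + int (flip J (Suc k)) - int (Suc k)"
    by (simp add: displacement_def)
  also have "\<dots> = (if Suc k \<in> J then 1 else 0)"
    using J by (auto simp: Suc flip_def sparse_sets_def)
  finally show ?case .
qed

lemma sum_highest_rho:
  assumes u: "u permutes {..<n}" and u0: "u 0 = 0" and n: "2 \<le> n"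
  shows "(\<Sum>i\<le>k. highest_rho n (u i) + int i) =
      1 - (if n - 1 \<in> u ` {..k} then 1 else 0) - displacement u k"
proof -
  have inj: "inj u"
    using u by (rule permutes_inj)
  have 0: "u i = 0 \<longleftrightarrow> i = 0" for i
    using u0 inj by (metis inj_eq)
  have "(\<Sum>i\<le>k. highest_rho n (u i) + int i) =
      (\<Sum>i\<le>k. if i = 0 then 1 else 0) - (\<Sum>i\<le>k. if Suc (u i) = n then 1 else 0) -
      displacement u k"
    by (simp add: highest_rho_def displacement_def sum.distrib sum_subtractf 0)
  moreover have "(\<Sum>i\<le>k. if Suc (u i) = n then 1 else 0) = (if n - 1 \<in> u ` {..k} then 1 else (0::int))"
  proof (cases "n - 1 \<in> u ` {..k}")
    case True
    then obtain j where j: "j \<le> k" "u j = n - 1"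
      by auto
    then have "Suc (u i) = n \<longleftrightarrow> i = j" for i
      using n inj_eq[OF inj, of i j] by auto
    then show ?thesis
      using j True by simp
  next
    case False
    then have "Suc (u i) \<noteq> n" if "i \<le> k" for i
      using that by force
    then show ?thesis
      using False by simp
  qed
  ultimately show ?thesis
    by simp
qed

text \<open>The partial sums in the hypothesis are the coefficients of \<open>\<sigma>(\<alpha> + \<rho>) - \<rho>\<close> in the simple
  roots, where \<open>u\<close> is the inverse of the permutation that gives \<open>\<sigma>\<close>. Nonnegativity at index 0
  gives \<open>u 0 = 0\<close>; the value \<open>n - 1\<close> cannot occur before the last index, because it costs one by
  itself and another one by being a positive displacement; all displacement sums are then
  \<open>0\<close> or \<open>1\<close>, and \<open>J\<close> is the set of indices where the sum is \<open>1\<close>.\<close>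

lemma nonneg_partial_sums_imp_flip:
  assumes u: "u permutes {..<n}" and n: "2 \<le> n"
    and nonneg: "\<And>k. Suc k < n \<Longrightarrow> 0 \<le> (\<Sum>i\<le>k. highest_rho n (u i) + int i)"
  shows "\<exists>J\<in>sparse_sets (n - 2). u = flip J"
proof -
  have inj: "inj u"
    using u by (rule permutes_inj)
  have u0: "u 0 = 0"
    using nonneg[of 0] n by (auto simp: highest_rho_def split: if_splits)
  note sums = sum_highest_rho[OF u u0 n]
  have d_ge: "0 \<le> displacement u k" for k
    using displacement_ge_card[OF inj, of k] by linarith
  have last_notin: "n - 1 \<notin> u ` {..k}" if k: "Suc k < n" for k
  proof
    assume mem: "n - 1 \<in> u ` {..k}"
    then have "n - 1 \<in> u ` {..k} - {..k}"
      using k by auto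
    then have "0 < card (u ` {..k} - {..k})"
      by (auto simp: card_gt_0_iff)
    then have "0 < displacement u k"
      using displacement_ge_card[OF inj, of k] by linarith
    then show False
      using nonneg[OF k] mem by (simp add: sums)
  qed
  have d_le: "displacement u k \<le> 1" if "Suc k < n" for k
    using nonneg[OF that] last_notin[OF that] by (simp add: sums)
  have last: "u (n - 1) = n - 1"
  proof -
    have "n - 1 \<in> u ` {..<n}"
      using permutes_image[OF u] n by auto
    then obtain j where j: "j < n" "u j = n - 1"
      by auto
    have "\<not> Suc j < n"
      using last_notin[of j] j(2) by (metis atMost_iff image_eqI order_refl)
    then show ?thesis
      using j by (metis Suc_lessI diff_Suc_1)
  qed
  have d_full: "displacement u (n - 1) = 0"
  proof -
    have "{..n - 1} = {..<n}"
      using n by auto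
    then show ?thesis
      using sum.permute[OF u, of int] by (simp add: displacement_def sum_subtractf o_def)
  qed
  have step: "displacement u (Suc k) = displacement u k + int (u (Suc k)) - int (Suc k)" for k
    by (simp add: displacement_def)
  have d_last: "displacement u (n - 2) = 0"
  proof -
    have "n - 1 = Suc (n - 2)"
      using n by simp
    then show ?thesis
      using d_full step[of "n - 2"] last by simp
  qed
  have d_0: "displacement u 0 = 0"
    by (simp add: displacement_def u0)
  define J where "J = {k. Suc k < n \<and> displacement u k = 1}"
  have d_J: "displacement u k = (if k \<in> J then 1 else 0)" if "Suc k < n" for k
    using d_ge[of k] d_le[OF that] that by (auto simp: J_def)
  have J_sub: "0 < k" "k < n - 2" if "k \<in> J" for k
  proof -
    have k: "Suc k < n" "displacement u k = 1"
      using that by (simp_all add: J_def)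
    have "k \<noteq> 0" "k \<noteq> n - 2"
      using k d_0 d_last by (metis zero_neq_one)+
    with k show "0 < k" "k < n - 2"
      by auto
  qed
  have u_Suc: "int (u (Suc k)) = int (Suc k) + (if Suc k \<in> J then 1 else 0) - (if k \<in> J then 1 else 0)"
    if "Suc (Suc k) < n" for k
    using step[of k] d_J[of k] d_J[of "Suc k"] that by simp
  \<comment> \<open>If \<open>j\<close> is least with \<open>j, j + 1 \<in> J\<close>, then \<open>u j = j + 1 = u (j + 1)\<close>, against injectivity.\<close>
  have sparse: "j \<in> J \<Longrightarrow> Suc j \<notin> J" for j
  proof (induction j rule: less_induct)
    case (less j)
    show ?case
    proof
      assume Suc_j: "Suc j \<in> J"
      have "Suc (Suc j) < n" "j \<noteq> 0"
        using J_sub[OF Suc_j] J_sub[OF less.prems] by auto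
      then obtain i where i: "j = Suc i"
        by (cases j) auto
      have "i \<notin> J"
        using less.IH[of i] less.prems i by auto
      then have "u (Suc i) = Suc j"
        using u_Suc[of i] less.prems i \<open>Suc (Suc j) < n\<close> by simp
      moreover have "u (Suc j) = Suc j"
        using u_Suc[of j] less.prems Suc_j \<open>Suc (Suc j) < n\<close> by simp
      ultimately show False
        using inj i by (metis inj_eq n_not_Suc_n)
    qed
  qed
  have J: "J \<in> sparse_sets (n - 2)"
    using J_sub sparse by (auto simp: sparse_sets_def)
  have "u k = flip J k" for k
  proof (cases "k < n")
    case True
    consider "k = 0" | i where "k = Suc i" "Suc k < n" | "k = n - 1"
      using True by (metis Suc_lessI diff_Suc_1 not0_implies_Suc)
    then show ?thesis
    proof cases
      case 1
      then show ?thesis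
        using J_sub(1)[of 0] u0 by (auto simp: flip_def)
    next
      case (2 i)
      then show ?thesis
        using u_Suc[of i] sparse[of i] by (auto simp: flip_def split: if_splits)
    next
      case 3
      then have "k \<notin> J" "k - 1 \<notin> J"
        using J_sub(2)[of k] J_sub(2)[of "k - 1"] by auto
      then show ?thesis
        using 3 last by (simp add: flip_def)
    qed
  next
    case False
    then show ?thesis
      using flip_permutes[OF J, of n] u n by (simp add: permutes_def)
  qed
  then show ?thesis
    using J by blast
qed

section \<open>Weights in coordinates\<close>

text \<open>The weight \<open>H \<mapsto> \<Sum>i. a\<^sub>i H\<^sub>i\<^sub>i\<close>, extended by 0 to all matrices. The vector \<open>a\<close> is
  determined by the weight only up to an additive constant.\<close>

definition coord_weight :: "nat \<Rightarrow> (nat \<Rightarrow> int) \<Rightarrow> weight" where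
  "coord_weight n a = (\<lambda>H. if H \<in> cartan n then \<Sum>i<n. of_int (a i) * H $$ (i, i) else 0)"

text \<open>The functional \<open>H \<mapsto> H\<^sub>i\<^sub>i - H\<^sub>j\<^sub>j\<close>, extended by 0 to all matrices; for \<open>i \<noteq> j\<close> it is the root
  \<open>e\<^sub>i - e\<^sub>j\<close>.\<close>

definition typeA_root :: "nat \<Rightarrow> nat \<Rightarrow> nat \<Rightarrow> weight" where
  "typeA_root n i j = (\<lambda>H. if H \<in> cartan n then H $$ (i, i) - H $$ (j, j) else 0)"

text \<open>The basis of the Cartan subalgebra dual to the simple roots: \<open>k + 1\<close> leading ones on the
  diagonal, made traceless by subtracting a scalar matrix. The basis is indexed by
  \<open>k < n - 1\<close>; for \<open>k = n - 1\<close> the matrix is zero.\<close>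

definition fund_coweight :: "nat \<Rightarrow> nat \<Rightarrow> complex mat" where
  "fund_coweight n k = mat n n (\<lambda>(i, j).
     if i = j then (if i \<le> k then 1 else 0) - of_nat (Suc k) / of_nat n else 0)"

lemma simple_root_eq_root: "simple_root n i = typeA_root n i (Suc i)"
  by (simp add: simple_root_def typeA_root_def)

lemma coord_weight_add: "coord_weight n a + coord_weight n b = coord_weight n (\<lambda>i. a i + b i)"
  by (auto simp: coord_weight_def fun_eq_iff sum.distrib algebra_simps)

lemma coord_weight_diff: "coord_weight n a - coord_weight n b = coord_weight n (\<lambda>i. a i - b i)"
  by (auto simp: coord_weight_def fun_eq_iff sum_subtractf algebra_simps)

lemma coord_weight_cartan_dual: "coord_weight n a \<in> cartan_dual n"
  unfolding cartan_dual_def coord_weight_def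
  by (auto simp: add_cartan smult_cartan, auto simp: cartan_iff sum.distrib sum_distrib_left algebra_simps)

lemma root_eq_coord_weight:
  assumes "i < n" "j < n"
  shows "typeA_root n i j = coord_weight n (\<lambda>l. (if l = i then 1 else 0) - (if l = j then 1 else 0))"
proof
  fix H :: "complex mat"
  have "(\<Sum>l<n. of_int ((if l = i then 1 else 0) - (if l = j then 1 else 0)) * H $$ (l, l)) =
      (\<Sum>l<n. (if l = i then H $$ (l, l) else 0) - (if l = j then H $$ (l, l) else 0))"
    by (intro sum.cong) auto
  also have "\<dots> = H $$ (i, i) - H $$ (j, j)"
    using assms by (simp add: sum_subtractf)
  finally show "typeA_root n i j H =
      coord_weight n (\<lambda>l. (if l = i then 1 else 0) - (if l = j then 1 else 0)) H"
    by (simp add: typeA_root_def coord_weight_def)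
qed

lemma fund_coweight_index:
  "i < n \<Longrightarrow> fund_coweight n k $$ (i, i) = (if i \<le> k then 1 else 0) - of_nat (Suc k) / of_nat n"
  by (simp add: fund_coweight_def)

lemma fund_coweight_cartan:
  assumes "k < n"
  shows "fund_coweight n k \<in> cartan n"
proof -
  have "(\<Sum>i<n. fund_coweight n k $$ (i, i)) =
      (\<Sum>i<n. (if i \<in> {..k} then 1 else 0) - of_nat (Suc k) / of_nat n)"
    by (intro sum.cong) (auto simp: fund_coweight_index)
  also have "\<dots> = of_nat (card ({..<n} \<inter> {..k})) - of_nat n * (of_nat (Suc k) / of_nat n)"
    by (simp only: sum_subtractf sum.If_cases finite_lessThan)
      (simp add: atMost_def)
  also have "{..<n} \<inter> {..k} = {..k}"
    using assms by auto
  finally show ?thesis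
    using assms by (auto simp: cartan_iff fund_coweight_def)
qed

lemma root_fund_coweight:
  assumes "i < n" "j < n" "k < n"
  shows "typeA_root n i j (fund_coweight n k) = (if i \<le> k then 1 else 0) - (if j \<le> k then 1 else 0)"
  using assms by (simp add: typeA_root_def fund_coweight_cartan fund_coweight_index)

lemma simple_root_fund_coweight:
  assumes "Suc i < n" "k < n"
  shows "simple_root n i (fund_coweight n k) = (if i = k then 1 else 0)"
  using assms by (auto simp: simple_root_eq_root root_fund_coweight)

lemma sum_simple_root_fund_coweight:
  assumes "finite S" "\<And>i. i \<in> S \<Longrightarrow> Suc i < n" "k < n"
  shows "(\<Sum>i\<in>S. simple_root n i) (fund_coweight n k) = (if k \<in> S then 1 else 0)"
  using assms by (simp add: sum_fun_apply simple_root_fund_coweight)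

lemma root_telescope:
  assumes "i \<le> j"
  shows "typeA_root n i j = (\<Sum>l\<in>{i..<j}. simple_root n l)"
  using assms
proof (induction j rule: dec_induct)
  case base
  then show ?case by (auto simp: typeA_root_def fun_eq_iff)
next
  case (step j)
  have "typeA_root n i (Suc j) = typeA_root n i j + simple_root n j"
    by (auto simp: typeA_root_def simple_root_def fun_eq_iff)
  then show ?case
    using step by simp
qed

lemma coord_weight_fund_coweight:
  assumes "(\<Sum>i<n. a i) = 0" "k < n"
  shows "coord_weight n a (fund_coweight n k) = of_int (\<Sum>i\<le>k. a i)"
proof -
  have "coord_weight n a (fund_coweight n k) =
      (\<Sum>i<n. (if i \<in> {..k} then of_int (a i) else 0) - of_int (a i) * (of_nat (Suc k) / of_nat n))"
    unfolding coord_weight_def using fund_coweight_cartan[OF assms(2)]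
    by (auto simp: fund_coweight_index algebra_simps intro!: sum.cong)
  also have "\<dots> = (\<Sum>i\<in>{..<n} \<inter> {..k}. of_int (a i)) - of_int (\<Sum>i<n. a i) * (of_nat (Suc k) / of_nat n)"
    by (simp only: sum_subtractf sum.If_cases finite_lessThan of_int_sum sum_distrib_right)
      (simp add: atMost_def)
  also have "{..<n} \<inter> {..k} = {..k}"
    using assms by auto
  finally show ?thesis
    using assms(1) by simp
qed

text \<open>By summation by parts; the boundary term vanishes because the coordinates sum to 0.\<close>

lemma coord_weight_eq_sum_simple_roots:
  assumes "(\<Sum>i<n. a i) = 0"
  shows "coord_weight n a =
    (\<Sum>k | Suc k < n. (\<lambda>H. of_int (\<Sum>i\<le>k. a i) * simple_root n k H))"
proof (cases n)
  case 0
  then show ?thesis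
    by (auto simp: coord_weight_def fun_eq_iff)
next
  case (Suc m)
  have parts: "(\<Sum>i\<le>m. of_int (a i) * h i) =
      (\<Sum>k<m. of_int (\<Sum>i\<le>k. a i) * (h k - h (Suc k))) + of_int (\<Sum>i\<le>m. a i) * h m"
    for m and h :: "nat \<Rightarrow> complex"
    by (induction m) (auto simp: algebra_simps)
  show ?thesis
  proof
    fix H
    have eq: "{k. Suc k < n} = {..<m}" "{..<n} = {..m}"
      using Suc by auto
    show "coord_weight n a H =
      (\<Sum>k | Suc k < n. (\<lambda>H. of_int (\<Sum>i\<le>k. a i) * simple_root n k H)) H"
      using parts[of "\<lambda>i. H $$ (i, i)" m] assms
      by (simp add: coord_weight_def sum_fun_apply eq simple_root_def del: of_int_sum)
  qed
qed

section \<open>Positive roots\<close>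

lemma commutator_cartan_index:
  assumes H: "H \<in> cartan n" and X: "X \<in> carrier_mat n n" and kl: "k < n" "l < n"
  shows "(H * X - X * H) $$ (k, l) = (H $$ (k, k) - H $$ (l, l)) * X $$ (k, l)"
proof -
  have Hc: "H \<in> carrier_mat n n"
    using H by (simp add: cartan_iff)
  have "(H * X) $$ (k, l) = (\<Sum>m<n. H $$ (k, m) * X $$ (m, l))"
    using Hc X kl by (simp add: scalar_prod_def atLeast0LessThan)
  also have "\<dots> = (\<Sum>m<n. if m = k then H $$ (k, k) * X $$ (k, l) else 0)"
    using H kl by (intro sum.cong) (auto simp: cartan_iff)
  finally have HX: "(H * X) $$ (k, l) = H $$ (k, k) * X $$ (k, l)"
    using kl by simp
  have "(X * H) $$ (k, l) = (\<Sum>m<n. X $$ (k, m) * H $$ (m, l))"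
    using Hc X kl by (simp add: scalar_prod_def atLeast0LessThan)
  also have "\<dots> = (\<Sum>m<n. if m = l then X $$ (k, l) * H $$ (l, l) else 0)"
    using H kl by (intro sum.cong) (auto simp: cartan_iff)
  finally have "(X * H) $$ (k, l) = X $$ (k, l) * H $$ (l, l)"
    using kl by simp
  with HX show ?thesis
    using Hc X kl by (simp add: algebra_simps)
qed

lemma root_mem_roots:
  assumes "i < n" "j < n" "i \<noteq> j"
  shows "typeA_root n i j \<in> roots n"
proof -
  define X :: "complex mat" where "X = mat n n (\<lambda>(k, l). if k = i \<and> l = j then 1 else 0)"
  have X: "X \<in> carrier_mat n n"
    by (simp add: X_def)
  have "X \<in> special_linear n"
    using assms(3) X by (auto simp: special_linear_def X_def intro!: sum.neutral)
  moreover have "H * X - X * H = typeA_root n i j H \<cdot>\<^sub>m X" if H: "H \<in> cartan n" for H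
  proof (rule eq_matI)
    fix k l assume "k < dim_row (typeA_root n i j H \<cdot>\<^sub>m X)" "l < dim_col (typeA_root n i j H \<cdot>\<^sub>m X)"
    then have kl: "k < n" "l < n"
      using X by auto
    show "(H * X - X * H) $$ (k, l) = (typeA_root n i j H \<cdot>\<^sub>m X) $$ (k, l)"
      unfolding commutator_cartan_index[OF H X kl] using kl H by (auto simp: typeA_root_def X_def)
  qed (use H X in \<open>auto simp: cartan_iff\<close>)
  moreover have "X \<noteq> 0\<^sub>m n n"
    using assms by (auto simp: X_def mat_eq_iff)
  moreover have "typeA_root n i j \<noteq> 0"
  proof
    assume "typeA_root n i j = 0"
    then have "typeA_root n i j (fund_coweight n (min i j)) = 0"
      by simp
    then show False
      using assms by (simp add: root_fund_coweight min_def split: if_splits)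
  qed
  moreover have "typeA_root n i j \<in> cartan_dual n"
    using assms by (simp add: root_eq_coord_weight coord_weight_cartan_dual)
  ultimately show ?thesis
    unfolding roots_def root_space_def by blast
qed

lemma roots_eq: "roots n = {typeA_root n i j | i j. i < n \<and> j < n \<and> i \<noteq> j}"
proof (intro equalityI subsetI)
  \<comment> \<open>A nonzero entry \<open>(k, l)\<close> of a root vector determines the root.\<close>
  fix \<alpha> assume "\<alpha> \<in> roots n"
  then obtain X where \<alpha>: "\<alpha> \<in> cartan_dual n" "\<alpha> \<noteq> 0" and X: "X \<in> root_space n \<alpha>" "X \<noteq> 0\<^sub>m n n"
    by (auto simp: roots_def)
  have Xc: "X \<in> carrier_mat n n"
    using X(1) by (simp add: root_space_def special_linear_def)
  obtain k l where kl: "k < n" "l < n" "X $$ (k, l) \<noteq> 0"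
    using X(2) Xc by (auto simp: mat_eq_iff)
  have val: "\<alpha> H = H $$ (k, k) - H $$ (l, l)" if H: "H \<in> cartan n" for H
  proof -
    have "H * X - X * H = \<alpha> H \<cdot>\<^sub>m X"
      using X(1) H by (simp add: root_space_def)
    then have "(H * X - X * H) $$ (k, l) = (\<alpha> H \<cdot>\<^sub>m X) $$ (k, l)"
      by simp
    then have "(H $$ (k, k) - H $$ (l, l)) * X $$ (k, l) = \<alpha> H * X $$ (k, l)"
      using Xc kl by (simp add: commutator_cartan_index[OF H Xc])
    then show ?thesis
      using kl(3) by simp
  qed
  have "\<alpha> = typeA_root n k l"
    using \<alpha>(1) val by (auto simp: typeA_root_def cartan_dual_def fun_eq_iff)
  moreover have "k \<noteq> l"
  proof
    assume "k = l"
    then have "\<alpha> = 0"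
      using \<open>\<alpha> = typeA_root n k l\<close> by (simp add: typeA_root_def fun_eq_iff)
    then show False
      using \<alpha>(2) by contradiction
  qed
  ultimately show "\<alpha> \<in> {typeA_root n i j | i j. i < n \<and> j < n \<and> i \<noteq> j}"
    using kl by blast
qed (auto intro: root_mem_roots)

lemma positive_roots_eq: "positive_roots n = {typeA_root n i j | i j. i < j \<and> j < n}"
proof (intro equalityI subsetI)
  fix \<alpha> assume \<alpha>: "\<alpha> \<in> positive_roots n"
  then obtain c :: "nat \<Rightarrow> nat" where
    c: "\<alpha> = (\<Sum>i | Suc i < n. (\<lambda>H. of_nat (c i) * simple_root n i H))"
    by (auto simp: positive_roots_def)
  obtain i j where ij: "\<alpha> = typeA_root n i j" "i < n" "j < n" "i \<noteq> j"
    using \<alpha> by (auto simp: positive_roots_def roots_eq)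
  have "i < j"
  proof (rule ccontr)
    \<comment> \<open>Otherwise the coefficient of the simple root with index \<open>j\<close> is \<open>-1\<close>.\<close>
    assume "\<not> i < j"
    with ij have ji: "j < i"
      by simp
    have "finite {i. Suc i < n}"
      by (rule finite_subset[of _ "{..<n}"]) auto
    then have "\<alpha> (fund_coweight n j) = of_nat (c j)"
      using ji ij(2) unfolding c
      by (simp add: sum_fun_apply simple_root_fund_coweight if_distrib cong: if_cong)
    moreover have "\<alpha> (fund_coweight n j) = - 1"
      using ji ij by (simp add: root_fund_coweight)
    ultimately have "Re (of_nat (c j)) = Re (- 1)"
      by metis
    then show False
      by simp
  qed
  then show "\<alpha> \<in> {typeA_root n i j | i j. i < j \<and> j < n}"
    using ij by blast
next
  fix \<alpha> assume "\<alpha> \<in> {typeA_root n i j | i j. i < j \<and> j < n}"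
  then obtain i j where ij: "\<alpha> = typeA_root n i j" "i < j" "j < n"
    by blast
  have "typeA_root n i j H = (\<Sum>k | Suc k < n. of_nat (if k \<in> {i..<j} then 1 else 0) * simple_root n k H)"
    for H
  proof -
    have finite: "finite {k. Suc k < n}"
      by (rule finite_subset[of _ "{..<n}"]) auto
    have "typeA_root n i j H = (\<Sum>k\<in>{i..<j}. simple_root n k H)"
      using ij by (simp add: root_telescope sum_fun_apply)
    also have "\<dots> = (\<Sum>k | Suc k < n. of_nat (if k \<in> {i..<j} then 1 else 0) * simple_root n k H)"
      using ij by (intro sum.mono_neutral_cong_left finite) auto
    finally show ?thesis .
  qed
  then have "\<alpha> = (\<Sum>k | Suc k < n. (\<lambda>H. of_nat (if k \<in> {i..<j} then 1 else 0) * simple_root n k H))"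
    unfolding ij(1) by (simp add: fun_eq_iff sum_fun_apply)
  moreover have "\<alpha> \<in> roots n"
    unfolding ij(1) using ij by (intro root_mem_roots) auto
  ultimately show "\<alpha> \<in> positive_roots n"
    unfolding positive_roots_def
    by (intro CollectI conjI exI[of _ "\<lambda>k. if k \<in> {i..<j} then 1 else 0"])
qed

lemma finite_positive_roots: "finite (positive_roots n)"
proof (rule finite_subset)
  show "positive_roots n \<subseteq> (\<lambda>(i, j). typeA_root n i j) ` ({..<n} \<times> {..<n})"
    by (auto simp: positive_roots_eq)
qed simp

lemma typeA_root_positive: "i < j \<Longrightarrow> j < n \<Longrightarrow> typeA_root n i j \<in> positive_roots n"
  unfolding positive_roots_eq by blast

lemma simple_root_positive: "Suc i < n \<Longrightarrow> simple_root n i \<in> positive_roots n"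
  by (simp add: simple_root_eq_root typeA_root_positive)

lemma inj_on_typeA_root: "inj_on (\<lambda>(i, j). typeA_root n i j) {(i, j). i < j \<and> j < n}"
proof (rule inj_onI, clarify)
  fix i j i' j'
  assume ij: "i < j" "j < n" "i' < j'" "j' < n" and eq: "typeA_root n i j = typeA_root n i' j'"
  have *: "(i \<le> k \<and> k < j) = (i' \<le> k \<and> k < j')" if "k < n" for k
  proof -
    have "typeA_root n i j (fund_coweight n k) = typeA_root n i' j' (fund_coweight n k)"
      by (simp add: eq)
    then show ?thesis
      using ij that by (auto simp: root_fund_coweight split: if_splits)
  qed
  have "i \<le> i'" "i' < j" "i' \<le> i"
    using *[of i] *[of i'] ij by auto
  moreover have "j \<le> j'" "j' \<le> j"
  proof -
    have "j - 1 < n" "j' - 1 < n"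
      using ij by auto
    from *[OF this(1)] *[OF this(2)] show "j \<le> j'" "j' \<le> j"
      using ij by linarith+
  qed
  ultimately show "i = i' \<and> j = j'"
    by simp
qed

text \<open>In coordinates \<open>\<rho> = (0, -1, \<dots>, -(n - 1))\<close>; this choice differs from the symmetric
  one by a multiple of the trace, which vanishes on the Cartan subalgebra.\<close>

lemma half_sum_eq: "half_sum n = coord_weight n (\<lambda>i. - int i)"
proof
  fix H
  show "half_sum n H = coord_weight n (\<lambda>i. - int i) H"
  proof (cases "H \<in> cartan n")
    case False
    then show ?thesis
      by (auto simp: half_sum_def coord_weight_def positive_roots_eq typeA_root_def intro!: sum.neutral)
  next
    case True
    define h where "h i = H $$ (i, i)" for i
    have tr: "(\<Sum>i<n. h i) = 0"
      using True by (simp add: cartan_iff h_def)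
    have pr: "positive_roots n = (\<lambda>(i, j). typeA_root n i j) ` {(i, j). i < j \<and> j < n}"
      by (auto simp: positive_roots_eq)
    have "(\<Sum>\<alpha>\<in>positive_roots n. \<alpha> H) = (\<Sum>(i, j)\<in>{(i, j). i < j \<and> j < n}. h i - h j)"
      unfolding pr using True
      by (subst sum.reindex[OF inj_on_typeA_root])
        (auto simp: typeA_root_def h_def intro!: sum.cong)
    also have "{(i, j). i < j \<and> j < n} = (\<lambda>(j, i). (i, j)) ` (SIGMA j:{..<n}. {..<j})"
      by auto
    also have "(\<Sum>(i, j)\<in>(\<lambda>(j, i). (i, j)) ` (SIGMA j:{..<n}. {..<j}). h i - h j) =
        (\<Sum>j<n. \<Sum>i<j. h i - h j)"
      by (subst sum.reindex) (auto simp: inj_on_def sum.Sigma intro!: sum.cong)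
    also have "\<dots> = of_nat n * (\<Sum>i<n. h i) - (\<Sum>i<n. h i) - 2 * (\<Sum>i<n. of_nat i * h i)"
      by (induction n) (auto simp: sum_subtractf algebra_simps)
    finally show ?thesis
      using True tr by (simp add: half_sum_def coord_weight_def h_def sum_negf)
  qed
qed

section \<open>Kostant partitions\<close>

text \<open>The height, the sum of the values at the fundamental coweights, is additive and at least 1
  on every positive root, so it bounds the number of parts.\<close>

lemma finite_kostant_partitions:
  "finite {M. set_mset M \<subseteq> positive_roots n \<and> \<Sum>\<^sub># M = \<xi>}"
proof -
  define ht where "ht \<xi> = (\<Sum>k<n. Re (\<xi> (fund_coweight n k)))" for \<xi>
  have ht1: "1 \<le> ht \<alpha>" if \<alpha>: "\<alpha> \<in> positive_roots n" for \<alpha>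
  proof -
    obtain i j where ij: "\<alpha> = typeA_root n i j" "i < j" "j < n"
      using \<alpha> unfolding positive_roots_eq by blast
    have "ht \<alpha> = (\<Sum>k<n. if k \<in> {i..<j} then 1 else 0)"
      unfolding ht_def using ij by (intro sum.cong) (auto simp: root_fund_coweight)
    also have "\<dots> \<ge> (\<Sum>k<n. if k = i then 1 else 0)"
      using ij by (intro sum_mono) auto
    finally show ?thesis
      using ij by simp
  qed
  have size_le: "real (size M) \<le> ht (\<Sum>\<^sub># M)" if "set_mset M \<subseteq> positive_roots n" for M
    using that
  proof (induction M)
    case empty
    then show ?case by (simp add: ht_def)
  next
    case (add \<alpha> M)
    have eq: "ht (\<Sum>\<^sub># (add_mset \<alpha> M)) = ht \<alpha> + ht (\<Sum>\<^sub># M)"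
      by (simp add: ht_def sum.distrib)
    have "1 \<le> ht \<alpha>" "real (size M) \<le> ht (\<Sum>\<^sub># M)"
      using add ht1 by auto
    then show ?case
      unfolding eq by simp
  qed
  have "{M. set_mset M \<subseteq> positive_roots n \<and> \<Sum>\<^sub># M = \<xi>} \<subseteq>
      (\<Union>m\<le>nat \<lfloor>ht \<xi>\<rfloor>. multisets_of_size (positive_roots n) m)"
    using size_le by (auto simp: multisets_of_size_def le_nat_floor)
  moreover have "finite (multisets_of_size (positive_roots n) m)" for m
    using finite_positive_roots by (rule finite_multisets_of_size)
  ultimately show ?thesis
    by (meson finite_UN_I finite_atMost finite_subset)
qed

lemma kostant_partition_pos_imp_Nats:
  assumes "0 < kostant_partition n \<xi>" "k < n"
  shows "\<xi> (fund_coweight n k) \<in> \<nat>"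
proof -
  obtain M where M: "set_mset M \<subseteq> positive_roots n" "\<xi> = \<Sum>\<^sub># M"
    using assms(1) by (force simp: kostant_partition_def card_gt_0_iff)
  show ?thesis
    unfolding M(2) using M(1)
  proof (induction M)
    case empty
    then show ?case by simp
  next
    case (add \<alpha> M)
    then have "\<alpha> (fund_coweight n k) \<in> \<nat>"
      using assms(2) by (auto simp: positive_roots_eq root_fund_coweight)
    then show ?case
      using add by auto
  qed
qed

lemma sum_mset_simple_roots:
  "\<Sum>\<^sub># (image_mset (simple_root n) (mset_set S)) = (\<Sum>i\<in>S. simple_root n i)"
  by (simp add: sum_unfold_sum_mset)

lemma kostant_partition_sum_simple_roots_pos:
  assumes "finite S" "\<And>i. i \<in> S \<Longrightarrow> Suc i < n"
  shows "0 < kostant_partition n (\<Sum>i\<in>S. simple_root n i)"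
  unfolding kostant_partition_def card_gt_0_iff
proof (intro conjI finite_kostant_partitions)
  have "image_mset (simple_root n) (mset_set S) \<in>
      {M. set_mset M \<subseteq> positive_roots n \<and> \<Sum>\<^sub># M = (\<Sum>i\<in>S. simple_root n i)}"
    using assms by (auto simp: sum_mset_simple_roots simple_root_positive)
  then show "{M. set_mset M \<subseteq> positive_roots n \<and> \<Sum>\<^sub># M = (\<Sum>i\<in>S. simple_root n i)} \<noteq> {}"
    by blast
qed

text \<open>Adding the part \<open>\<alpha>\<^sub>i\<close> injects the partitions for \<open>S\<close> into those for \<open>S \<union> {i}\<close>. It misses
  the partition into the root \<open>\<alpha>\<^sub>i + \<alpha>\<^sub>i\<^sub>+\<^sub>1\<close> and the simple roots with the remaining indices.\<close>

lemma kostant_partition_insert_less: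
  assumes "finite S" "\<And>j. j \<in> S \<Longrightarrow> Suc j < n" "i \<notin> S" "Suc i \<in> S"
  shows "kostant_partition n (\<Sum>j\<in>S. simple_root n j) <
    kostant_partition n (\<Sum>j\<in>insert i S. simple_root n j)"
proof -
  let ?P = "\<lambda>S. {M. set_mset M \<subseteq> positive_roots n \<and> \<Sum>\<^sub># M = (\<Sum>j\<in>S. simple_root n j)}"
  have i: "Suc (Suc i) < n"
    using assms by blast
  define M where
    "M = add_mset (typeA_root n i (Suc (Suc i))) (image_mset (simple_root n) (mset_set (S - {Suc i})))"
  have "typeA_root n i (Suc (Suc i)) = simple_root n i + simple_root n (Suc i)"
    using root_telescope[of i "Suc (Suc i)" n] by simp
  then have "\<Sum>\<^sub># M = (\<Sum>j\<in>insert i S. simple_root n j)"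
    using assms by (simp add: M_def sum_mset_simple_roots sum.remove[of S "Suc i"] add_ac)
  moreover have "set_mset M \<subseteq> positive_roots n"
    using assms i by (auto simp: M_def simple_root_positive intro: typeA_root_positive)
  ultimately have M: "M \<in> ?P (insert i S)"
    by simp
  have "simple_root n i \<noteq> typeA_root n i (Suc (Suc i))"
  proof
    assume "simple_root n i = typeA_root n i (Suc (Suc i))"
    then have "simple_root n i (fund_coweight n (Suc i)) =
        typeA_root n i (Suc (Suc i)) (fund_coweight n (Suc i))"
      by simp
    then show False
      using i by (simp add: simple_root_fund_coweight root_fund_coweight)
  qed
  moreover have "simple_root n i \<noteq> simple_root n j" if "j \<in> S" for j
  proof
    assume "simple_root n i = simple_root n j"
    then have "simple_root n i (fund_coweight n i) = simple_root n j (fund_coweight n i)"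
      by simp
    then show False
      using i that assms by (auto simp: simple_root_fund_coweight split: if_splits)
  qed
  ultimately have notin: "simple_root n i \<notin># M"
    using assms by (auto simp: M_def)
  have "add_mset (simple_root n i) ` ?P S \<subset> ?P (insert i S)"
  proof
    show "add_mset (simple_root n i) ` ?P S \<subseteq> ?P (insert i S)"
    proof
      fix N assume "N \<in> add_mset (simple_root n i) ` ?P S"
      then obtain M' where M': "N = add_mset (simple_root n i) M'" "set_mset M' \<subseteq> positive_roots n"
        "\<Sum>\<^sub># M' = (\<Sum>j\<in>S. simple_root n j)"
        by blast
      then show "N \<in> ?P (insert i S)"
        using assms(1,3) simple_root_positive[of i n] i by simp
    qed
    show "add_mset (simple_root n i) ` ?P S \<noteq> ?P (insert i S)"
      using M notin by (metis (no_types, lifting) image_iff union_single_eq_member)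
  qed
  then have "card (add_mset (simple_root n i) ` ?P S) < card (?P (insert i S))"
    by (rule psubset_card_mono[OF finite_kostant_partitions])
  also have "card (add_mset (simple_root n i) ` ?P S) = card (?P S)"
    by (rule card_image) (simp add: inj_on_def)
  finally show ?thesis
    by (simp add: kostant_partition_def)
qed

section \<open>The alternation set\<close>

lemma weyl_perm_coord_weight:
  assumes p: "p permutes {..<n}"
  shows "weyl_perm n p (coord_weight n a) = coord_weight n (\<lambda>i. a (Hilbert_Choice.inv p i))"
proof
  fix H
  show "weyl_perm n p (coord_weight n a) H = coord_weight n (\<lambda>i. a (Hilbert_Choice.inv p i)) H"
  proof (cases "H \<in> cartan n")
    case True
    have "(\<Sum>i<n. of_int (a i) * permute_mat n p H $$ (i, i)) =
        (\<Sum>i<n. of_int (a (Hilbert_Choice.inv p (p i))) * H $$ (p i, p i))"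
      by (intro sum.cong) (auto simp: permutes_inverses[OF p])
    also have "\<dots> = (\<Sum>i<n. of_int (a (Hilbert_Choice.inv p i)) * H $$ (i, i))"
      using sum.permute[OF p, of "\<lambda>i. of_int (a (Hilbert_Choice.inv p i)) * H $$ (i, i)"]
      by (simp add: o_def)
    finally show ?thesis
      using True permute_mat_cartan[OF p True]
      by (simp add: weyl_perm_apply[OF coord_weight_cartan_dual], simp add: coord_weight_def)
  next
    case False
    then show ?thesis
      by (simp add: weyl_perm_apply[OF coord_weight_cartan_dual], simp add: coord_weight_def)
  qed
qed

lemma highest_root_plus_half_sum:
  "(\<Sum>i<r. simple_root (r + 1) i) + half_sum (r + 1) = coord_weight (r + 1) (highest_rho (r + 1))"
proof -
  have sum_eq: "(\<Sum>i<r. simple_root (r + 1) i) = typeA_root (r + 1) 0 r"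
    using root_telescope[of 0 r "r + 1"] by (simp add: atLeast0LessThan)
  show ?thesis
    unfolding sum_eq
    by (simp add: root_eq_coord_weight half_sum_eq coord_weight_add highest_rho_def [abs_def])
qed

text \<open>The weight \<open>\<sigma>(\<alpha> + \<rho>) - \<rho>\<close>, for \<open>\<alpha>\<close> the highest root and \<open>\<sigma>\<close> given by \<open>p\<close>.\<close>

definition shifted_weight :: "nat \<Rightarrow> (nat \<Rightarrow> nat) \<Rightarrow> weight" where
  "shifted_weight n p = weyl_perm n p (coord_weight n (highest_rho n)) - half_sum n"

lemma shifted_weight_eq:
  assumes p: "p permutes {..<n}"
  shows "shifted_weight n p = coord_weight n (\<lambda>i. highest_rho n (Hilbert_Choice.inv p i) + int i)"
  by (simp add: shifted_weight_def weyl_perm_coord_weight[OF p] half_sum_eq coord_weight_diff)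

lemma sum_shifted_coords:
  assumes u: "u permutes {..<n}" and n: "2 \<le> n"
  shows "(\<Sum>i<n. highest_rho n (u i) + int i) = 0"
proof -
  have "(\<Sum>i<n. highest_rho n (u i)) = (\<Sum>i<n. highest_rho n i)"
    using sum.permute[OF u, of "highest_rho n"] by (simp add: o_def)
  also have "\<dots> = (\<Sum>i<n. (if i = 0 then 1 else 0) - (if i = n - 1 then 1 else 0) - int i)"
    using n by (intro sum.cong) (auto simp: highest_rho_def)
  also have "\<dots> = - (\<Sum>i<n. int i)"
    using n by (simp add: sum_subtractf)
  finally show ?thesis
    by (simp add: sum.distrib)
qed

lemma kostant_pos_imp_flip:
  assumes p: "p permutes {..<n}" and n: "2 \<le> n"
    and pos: "0 < kostant_partition n (shifted_weight n p)"
  shows "\<exists>J\<in>sparse_sets (n - 2). p = flip J"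
proof -
  let ?u = "Hilbert_Choice.inv p"
  have u: "?u permutes {..<n}"
    using p by (rule permutes_inv)
  have "0 \<le> (\<Sum>i\<le>k. highest_rho n (?u i) + int i)" if "Suc k < n" for k
  proof -
    have "shifted_weight n p (fund_coweight n k) \<in> \<nat>"
      using kostant_partition_pos_imp_Nats[OF pos] that by simp
    then have "of_int (\<Sum>i\<le>k. highest_rho n (?u i) + int i) \<in> (\<nat> :: complex set)"
      unfolding shifted_weight_eq[OF p]
      using coord_weight_fund_coweight[OF sum_shifted_coords[OF u n], of k] that by simp
    then obtain m where "of_int (\<Sum>i\<le>k. highest_rho n (?u i) + int i) = (of_nat m :: complex)"
      by (auto simp only: Nats_def)
    then have "(\<Sum>i\<le>k. highest_rho n (?u i) + int i) = int m"
      by (metis of_int_eq_iff of_int_of_nat_eq)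
    then show ?thesis
      by simp
  qed
  then obtain J where J: "J \<in> sparse_sets (n - 2)" "?u = flip J"
    using nonneg_partial_sums_imp_flip[OF u n] by blast
  then have "p = flip J"
    using inv_flip[OF J(1)] permutes_inv_inv[OF p] by simp
  then show ?thesis
    using J(1) by blast
qed

lemma shifted_weight_flip:
  assumes J: "J \<in> sparse_sets (n - 2)" and n: "2 \<le> n"
  shows "shifted_weight n (flip J) = (\<Sum>k | Suc k < n \<and> k \<notin> J. simple_root n k)"
proof -
  have J': "0 < k" "Suc (Suc k) < n" if "k \<in> J" for k
    using J that by (auto simp: sparse_sets_def)
  have u: "flip J permutes {..<n}"
    using J n by (intro flip_permutes) auto
  have u0: "flip J 0 = 0"
    using J' by (auto simp: flip_def)
  have psum: "(\<Sum>i\<le>k. highest_rho n (flip J i) + int i) = (if k \<in> J then 0 else 1)"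
    if k: "Suc k < n" for k
  proof -
    have "flip J i < n - 1" if "i \<le> k" for i
      using J'[of i] that k by (auto simp: flip_def)
    then have "n - 1 \<notin> flip J ` {..k}"
      by force
    then show ?thesis
      by (simp add: sum_highest_rho[OF u u0 n] displacement_flip[OF J])
  qed
  have fin: "finite {k. Suc k < n}"
    by (rule finite_subset[of _ "{..<n}"]) auto
  have "shifted_weight n (flip J) = coord_weight n (\<lambda>i. highest_rho n (flip J i) + int i)"
    by (simp add: shifted_weight_eq[OF u] inv_flip[OF J])
  also have "\<dots> = (\<Sum>k | Suc k < n. (\<lambda>H. of_int (\<Sum>i\<le>k. highest_rho n (flip J i) + int i) * simple_root n k H))"
    by (rule coord_weight_eq_sum_simple_roots[OF sum_shifted_coords[OF u n]])
  also have "\<dots> = (\<Sum>k | Suc k < n. if k \<in> J then 0 else simple_root n k)"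
    by (intro sum.cong) (auto simp: psum fun_eq_iff simp del: of_int_sum of_int_add)
  also have "\<dots> = (\<Sum>k | Suc k < n \<and> k \<notin> J. simple_root n k)"
    using fin by (intro sum.mono_neutral_cong_right) auto
  finally show ?thesis .
qed

lemma weyl_perm_flip_mem_weyl_group:
  assumes "J \<in> sparse_sets (n - 2)"
  shows "weyl_perm n (flip J) \<in> weyl_group n"
proof -
  have "finite J"
    using assms by (auto simp: sparse_sets_def intro: finite_subset[of _ "{..<n - 2}"])
  then show ?thesis
    using assms
  proof (induction J)
    case empty
    show ?case
      unfolding weyl_group_def flip_empty weyl_perm_one[symmetric] by (rule generate.one)
  next
    case (insert i J)
    have i: "Suc i < n"
      using insert.prems by (auto simp: sparse_sets_def)
    have J: "J \<in> sparse_sets (n - 2)"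
      using insert.prems sparse_sets_subset by blast
    have "weyl_perm n (flip (insert i J)) =
        weyl_perm n (adj_swap i) \<otimes>\<^bsub>BijGroup (cartan_dual n)\<^esub> weyl_perm n (flip J)"
      using flip_insert(1)[OF insert.prems insert.hyps(2)] i flip_permutes[OF J, of n]
      by (simp add: weyl_perm_mult adj_swap_permutes)
    moreover have "weyl_perm n (adj_swap i) \<in> weyl_group n"
      unfolding weyl_group_def simple_reflection_eq_weyl_perm[OF i, symmetric]
      using i by (intro generate.incl) auto
    ultimately show ?case
      using insert.IH[OF J] unfolding weyl_group_def by (simp add: generate.eng)
  qed
qed

lemma kostant_shifted_flip_pos:
  assumes "J \<in> sparse_sets (n - 2)" "2 \<le> n"
  shows "0 < kostant_partition n (shifted_weight n (flip J))"
  unfolding shifted_weight_flip[OF assms]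
  by (rule kostant_partition_sum_simple_roots_pos)
    (auto intro: finite_subset[of _ "{..<n}"])

text \<open>Here \<open>i\<close> has its neighbour \<open>i + 1\<close> among the indices outside \<open>insert i J\<close>, because that set
  has no consecutive elements and stays below \<open>n - 2\<close>.\<close>

lemma kostant_shifted_flip_insert_less:
  assumes J: "insert i J \<in> sparse_sets (n - 2)" "i \<notin> J" and n: "2 \<le> n"
  shows "kostant_partition n (shifted_weight n (flip (insert i J))) <
    kostant_partition n (shifted_weight n (flip J))"
proof -
  let ?S = "{k. Suc k < n \<and> k \<notin> insert i J}"
  have J': "J \<in> sparse_sets (n - 2)"
    using J(1) sparse_sets_subset by blast
  have i: "Suc (Suc i) < n" "Suc i \<notin> insert i J"
    using J(1) by (auto simp: sparse_sets_def)
  have "insert i ?S = {k. Suc k < n \<and> k \<notin> J}"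
    using J(2) i by auto
  moreover have "kostant_partition n (\<Sum>j\<in>?S. simple_root n j) <
      kostant_partition n (\<Sum>j\<in>insert i ?S. simple_root n j)"
    using i by (intro kostant_partition_insert_less) (auto intro: finite_subset[of _ "{..<n}"])
  ultimately show ?thesis
    by (simp add: shifted_weight_flip[OF J(1) n] shifted_weight_flip[OF J' n])
qed

lemma inj_on_weyl_perm_flip:
  assumes n: "2 \<le> n"
  shows "inj_on (\<lambda>J. weyl_perm n (flip J)) (sparse_sets (n - 2))"
proof (rule inj_onI)
  fix J K
  assume J: "J \<in> sparse_sets (n - 2)" and K: "K \<in> sparse_sets (n - 2)"
    and "weyl_perm n (flip J) = weyl_perm n (flip K)"
  then have eq: "(\<Sum>k | Suc k < n \<and> k \<notin> J. simple_root n k) =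
      (\<Sum>k | Suc k < n \<and> k \<notin> K. simple_root n k)"
    using shifted_weight_flip[OF J n] shifted_weight_flip[OF K n]
    by (simp add: shifted_weight_def)
  have ev: "(\<Sum>k | Suc k < n \<and> k \<notin> L. simple_root n k) (fund_coweight n k) =
      (if Suc k < n \<and> k \<notin> L then 1 else 0)" if "k < n" for k L
    using that by (subst sum_simple_root_fund_coweight) (auto intro: finite_subset[of _ "{..<n}"])
  have "k \<in> J \<longleftrightarrow> k \<in> K" for k
  proof (cases "Suc k < n")
    case True
    then show ?thesis
      using ev[of k J] ev[of k K] eq by (auto split: if_splits)
  next
    case False
    then show ?thesis
      using J K by (auto simp: sparse_sets_def)
  qed
  then show "J = K"
    by blast
qed

theorem theorem4p1:
  fixes r :: nat and \<alpha>_tilde :: weight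
  assumes "r \<ge> 1"
    and "\<alpha>_tilde = (\<Sum>i<r. simple_root (r + 1) i)"
  shows "card (collapsed_weyl_alternation_set (r + 1) \<alpha>_tilde 0) = fib r"
proof -
  define n where "n = r + 1"
  have n: "2 \<le> n"
    using assms(1) by (simp add: n_def)
  let ?G = "BijGroup (cartan_dual n)"
  have hw: "\<alpha>_tilde + half_sum n = coord_weight n (highest_rho n)"
    unfolding assms(2) n_def by (rule highest_root_plus_half_sum)
  have "weyl_alternation_set n \<alpha>_tilde 0 = (\<lambda>J. weyl_perm n (flip J)) ` sparse_sets (n - 2)"
  proof (intro equalityI subsetI)
    fix \<sigma> assume "\<sigma> \<in> weyl_alternation_set n \<alpha>_tilde 0"
    then have \<sigma>: "\<sigma> \<in> weyl_group n"
      "0 < kostant_partition n (\<sigma> (coord_weight n (highest_rho n)) - half_sum n)"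
      by (simp_all add: weyl_alternation_set_def hw)
    obtain p where p: "p permutes {..<n}" "\<sigma> = weyl_perm n p"
      using weyl_group_subset_weyl_perm[OF \<sigma>(1)] by blast
    then show "\<sigma> \<in> (\<lambda>J. weyl_perm n (flip J)) ` sparse_sets (n - 2)"
      using kostant_pos_imp_flip[OF p(1) n] \<sigma>(2) by (auto simp: shifted_weight_def)
  next
    fix \<sigma> assume "\<sigma> \<in> (\<lambda>J. weyl_perm n (flip J)) ` sparse_sets (n - 2)"
    then show "\<sigma> \<in> weyl_alternation_set n \<alpha>_tilde 0"
      using weyl_perm_flip_mem_weyl_group kostant_shifted_flip_pos[OF _ n]
      by (auto simp: weyl_alternation_set_def hw shifted_weight_def)
  qed
  \<comment> \<open>Collapsing removes nothing.\<close>
  moreover have "kostant_partition n (weyl_perm n (flip J) (\<alpha>_tilde + half_sum n) - half_sum n - 0) \<noteq>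
      kostant_partition n
        ((weyl_perm n (flip J) \<otimes>\<^bsub>?G\<^esub> simple_reflection n i) (\<alpha>_tilde + half_sum n) - half_sum n - 0)"
    if J: "J \<in> sparse_sets (n - 2)" and i: "Suc i < n" for J i
  proof
    have fJ: "flip J permutes {..<n}"
      using flip_permutes[OF J] n by simp
    have q: "flip J \<circ> adj_swap i permutes {..<n}"
      using fJ adj_swap_permutes[OF i] by (intro permutes_compose)
    assume "kostant_partition n (weyl_perm n (flip J) (\<alpha>_tilde + half_sum n) - half_sum n - 0) =
      kostant_partition n
        ((weyl_perm n (flip J) \<otimes>\<^bsub>?G\<^esub> simple_reflection n i) (\<alpha>_tilde + half_sum n) - half_sum n - 0)"
    then have eq: "kostant_partition n (shifted_weight n (flip J)) =
        kostant_partition n (shifted_weight n (flip J \<circ> adj_swap i))"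
      by (simp add: simple_reflection_eq_weyl_perm[OF i] weyl_perm_mult[OF fJ adj_swap_permutes[OF i]]
          hw shifted_weight_def)
    then obtain K where K: "K \<in> sparse_sets (n - 2)" "flip J \<circ> adj_swap i = flip K"
      using kostant_pos_imp_flip[OF q n] kostant_shifted_flip_pos[OF J n] by auto
    have "i \<notin> J \<and> K = insert i J \<or> i \<notin> K \<and> J = insert i K"
      using flip_adj_swap_eq_flip[OF J K] .
    then show False
      using eq K kostant_shifted_flip_insert_less[of i J n] kostant_shifted_flip_insert_less[of i K n] J n
      by auto
  qed
  ultimately have "collapsed_weyl_alternation_set n \<alpha>_tilde 0 =
      (\<lambda>J. weyl_perm n (flip J)) ` sparse_sets (n - 2)"
    unfolding collapsed_weyl_alternation_set_def by auto
  then have "card (collapsed_weyl_alternation_set n \<alpha>_tilde 0) = card (sparse_sets (n - 2))"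
    by (simp add: card_image[OF inj_on_weyl_perm_flip[OF n]])
  also have "\<dots> = fib r"
    using assms(1) by (simp add: card_sparse_sets n_def)
  finally show ?thesis
    unfolding n_def .
qed

end
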